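(* Let $\delta\geq 1$, $k\geq 0$, $h=k+1$ and $t\geq 1$ be integers, and let $n\geq 2$ and $m$ be integers with $2m\geq n\delta$. There is a graph $G$ of order $n$ with $m$ edges and minimum degree $\delta$ such that $\mathrm{sp}(G,k)=f_t(n,m,\delta,k)$ if and only if there is an integer $s$ with $$\frac{n}{t+1}\leq s\leq\frac{n}{t}\qquad\text{and}\qquad 2m=n(\delta+th)-\frac{s\,h\,t(t+1)}{2}$$ such that the sequence $P$ consisting of $s$ copies of each of $\delta,\delta+h,\ldots,\delta+(t-1)h$ and $n-ts$ copies of $\delta+th$ is graphic. Moreover, for an integer $s$ satisfying the two displayed conditions, $P$ is graphic whenever $$n\geq\frac{(2\delta+th+1)^2}{4\delta},$$ and, if $k=0$, $P$ is graphic if and only if $n$ exceeds the largest term of $P$.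
   Context: Graphs are finite and simple; a sequence of integers is graphic if it is the degree sequence of a graph. For a graph $G$ and $B\subseteq V(G)$ the spread is $\mathrm{sp}(B)=\max_{u\in B}\deg_G(u)-\min_{v\in B}\deg_G(v)$, and $\mathrm{sp}(G,k)$ is the largest cardinality of a set $B\subseteq V(G)$ with $\mathrm{sp}(B)\leq k$. Further, $$f_t(n,m,\delta,k)=\frac{2\left(n(\delta+t(k+1))-2m\right)}{(k+1)\,t(t+1)}.$$ *)

theory Defs
  imports Complex_Main
begin

text \<open>Finite simple graphs: the edges are two-element sets of vertices.\<close>

record 'a graph =
  verts :: "'a set"
  edges :: "'a set set"

definition simple_graph :: "'a graph \<Rightarrow> bool" where
  "simple_graph G \<longleftrightarrow> finite (verts G) \<and> (\<forall>e \<in> edges G. e \<subseteq> verts G \<and> card e = 2)"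

definition degree :: "'a graph \<Rightarrow> 'a \<Rightarrow> nat" where
  "degree G v = card {e \<in> edges G. v \<in> e}"

text \<open>The next three notions take \<open>Max\<close> or \<open>Min\<close> and are meaningful only
  for a nonempty vertex set (respectively a nonempty \<open>B\<close>).\<close>

definition min_degree :: "'a graph \<Rightarrow> nat" where
  "min_degree G = Min (degree G ` verts G)"

definition spread :: "'a graph \<Rightarrow> 'a set \<Rightarrow> int" where
  "spread G B = int (Max (degree G ` B)) - int (Min (degree G ` B))"

definition sp :: "'a graph \<Rightarrow> nat \<Rightarrow> nat" where
  "sp G k = Max (card ` {B. B \<subseteq> verts G \<and> B \<noteq> {} \<and> spread G B \<le> int k})"

text \<open>A finite graph is isomorphic to one whose vertices are natural numbers, so
  existence of a graph is expressed with vertices of type \<^typ>\<open>nat\<close>. The list of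
  vertices \<open>vs\<close> is an arbitrary enumeration: no order of the terms is imposed.\<close>

definition graphic :: "nat list \<Rightarrow> bool" where
  "graphic ds \<longleftrightarrow> (\<exists>(G :: nat graph) vs. simple_graph G \<and>
     distinct vs \<and> set vs = verts G \<and> map (degree G) vs = ds)"

definition f_bound :: "nat \<Rightarrow> nat \<Rightarrow> nat \<Rightarrow> nat \<Rightarrow> nat \<Rightarrow> real" where
  "f_bound t n m \<delta> k =
     2 * (real n * (real \<delta> + real t * (real k + 1)) - 2 * real m)
       / ((real k + 1) * real t * (real t + 1))"

definition s_condition :: "nat \<Rightarrow> nat \<Rightarrow> nat \<Rightarrow> nat \<Rightarrow> nat \<Rightarrow> nat \<Rightarrow> bool" where
  "s_condition t n m \<delta> h s \<longleftrightarrow>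
     real n / (real t + 1) \<le> real s \<and> real s \<le> real n / real t \<and>
     2 * real m = real n * (real \<delta> + real t * real h)
       - real s * real h * real t * (real t + 1) / 2"

text \<open>The truncated subtraction \<open>n - t * s\<close> is exact whenever \<open>s \<le> n / t\<close>,
  which \<^const>\<open>s_condition\<close> guarantees.\<close>

definition P_seq :: "nat \<Rightarrow> nat \<Rightarrow> nat \<Rightarrow> nat \<Rightarrow> nat \<Rightarrow> nat list" where
  "P_seq t n \<delta> h s =
     concat (map (\<lambda>i. replicate s (\<delta> + i * h)) [0..<t]) @ replicate (n - t * s) (\<delta> + t * h)"

end

theory Submission
  imports Defs "HOL-Combinatorics.Permutations"
begin

text \<open>Put each vertex \<open>v\<close> into the class \<open>(deg v - \<delta>) div h\<close>. A class has spread at most \<open>k\<close>, hence at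
  most \<open>sp G k\<close> members, and this bounds the degree sum from below; the bound is attained exactly
  if the degree sequence is \<open>P\<close>. The graphs realizing \<open>P\<close> come from the Erdos-Gallai theorem.
  Under the bound on \<open>n\<close> its inequalities reduce to the sign of a quadratic polynomial. For \<open>h = 1\<close>
  they compare \<open>P\<close> with its conjugate, whose steps are \<open>s\<close> times as steep, so that only the
  last inequality inside the Durfee square is in danger.\<close>

section \<open>Degrees\<close>

text \<open>The edge-count condition on \<open>s\<close> says exactly that \<open>P\<close> sums to
  \<open>2 * m\<close>, so parity is automatic and only inequalities remain. A graph can miss the
  lower bound on its degree sum in three ways: nonzero remainders modulo \<open>h\<close>, vertices
  in classes above \<open>t\<close>, and classes below \<open>t\<close> with fewer than
  \<open>sp G k\<close> members. The equation with \<open>f_bound\<close> makes a positive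
  combination of these three losses vanish, hence each of them. The range of \<open>s\<close> then
  comes for free: it says that class \<open>t\<close> has between 0 and \<open>s\<close> members.
  For \<open>k = 0\<close> the quadratic criterion is too weak: with \<open>\<delta> = 1\<close> it
  asks for \<open>n\<close> of order \<open>t\<close> squared, while exceeding the largest term is a
  condition linear in \<open>t\<close>. What saves this case is that \<open>n\<close> exceeding the
  largest term forces \<open>s \<ge> 2\<close>.\<close>

definition nbrs :: "'a graph \<Rightarrow> 'a \<Rightarrow> 'a set" where
  "nbrs G v = {w. {v, w} \<in> edges G}"

definition add_edge :: "'a \<Rightarrow> 'a \<Rightarrow> 'a graph \<Rightarrow> 'a graph" where
  "add_edge u v G = G\<lparr>edges := insert {u, v} (edges G)\<rparr>"

definition del_edge :: "'a \<Rightarrow> 'a \<Rightarrow> 'a graph \<Rightarrow> 'a graph" where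
  "del_edge u v G = G\<lparr>edges := edges G - {{u, v}}\<rparr>"

lemma verts_add_edge [simp]: "verts (add_edge u v G) = verts G"
  and edges_add_edge [simp]: "edges (add_edge u v G) = insert {u, v} (edges G)"
  and verts_del_edge [simp]: "verts (del_edge u v G) = verts G"
  and edges_del_edge [simp]: "edges (del_edge u v G) = edges G - {{u, v}}"
  by (simp_all add: add_edge_def del_edge_def)

lemma simple_graph_add_edge:
  "simple_graph G \<Longrightarrow> u \<in> verts G \<Longrightarrow> v \<in> verts G \<Longrightarrow> u \<noteq> v \<Longrightarrow> simple_graph (add_edge u v G)"
  by (auto simp: simple_graph_def)

lemma simple_graph_del_edge: "simple_graph G \<Longrightarrow> simple_graph (del_edge u v G)"
  by (auto simp: simple_graph_def)

lemma finite_edges: "simple_graph G \<Longrightarrow> finite (edges G)"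
  by (rule finite_subset[of _ "Pow (verts G)"]) (auto simp: simple_graph_def)

lemma edge_verts:
  assumes "simple_graph G" "{v, w} \<in> edges G"
  shows "v \<in> verts G" "w \<in> verts G" "v \<noteq> w"
proof -
  have "{v, w} \<subseteq> verts G" "card {v, w} = 2" using assms unfolding simple_graph_def by blast+
  then show "v \<in> verts G" "w \<in> verts G" "v \<noteq> w" by auto
qed

lemma degree_add_edge:
  assumes "simple_graph G" "{u, v} \<notin> edges G"
  shows "degree (add_edge u v G) w = degree G w + of_bool (w = u \<or> w = v)"
proof -
  have "{e \<in> edges (add_edge u v G). w \<in> e} =
      (if w = u \<or> w = v then insert {u, v} {e \<in> edges G. w \<in> e} else {e \<in> edges G. w \<in> e})"
    by auto
  then show ?thesis
    using assms finite_edges[OF assms(1)] by (simp add: degree_def)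
qed

lemma degree_del_edge:
  assumes "simple_graph G" "{u, v} \<in> edges G"
  shows "degree G w = degree (del_edge u v G) w + of_bool (w = u \<or> w = v)"
proof -
  have "add_edge u v (del_edge u v G) = G"
    using assms by (cases G) (auto simp: add_edge_def del_edge_def)
  then show ?thesis
    using degree_add_edge[OF simple_graph_del_edge[OF assms(1)], of u v u v w] by simp
qed

text \<open>Swinging an edge at \<open>u\<close> from \<open>l\<close> to \<open>r\<close> transfers
  one unit of degree from \<open>l\<close> to \<open>r\<close> and leaves \<open>u\<close> alone.
  The exchanges below that involve a saturated vertex start this way and then repay it with a new
  edge.\<close>

lemma shift_edge:
  assumes G: "simple_graph G" and old: "{u, l} \<in> edges G" and new: "{u, r} \<notin> edges G"
    and r: "r \<in> verts G" "u \<noteq> r"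
  shows "simple_graph (add_edge u r (del_edge u l G))"
    and "degree (add_edge u r (del_edge u l G)) w + of_bool (w = l) = degree G w + of_bool (w = r)"
proof -
  have del: "simple_graph (del_edge u l G)" by (rule simple_graph_del_edge[OF G])
  then show "simple_graph (add_edge u r (del_edge u l G))"
    by (rule simple_graph_add_edge) (use edge_verts[OF G old] r in auto)
  have "{u, r} \<notin> edges (del_edge u l G)" using new by simp
  from degree_add_edge[OF del this, of w] degree_del_edge[OF G old, of w]
  show "degree (add_edge u r (del_edge u l G)) w + of_bool (w = l) = degree G w + of_bool (w = r)"
    using edge_verts(3)[OF G old] r(2) by (cases "w = u") auto
qed

lemma nbrs_subset: "simple_graph G \<Longrightarrow> nbrs G v \<subseteq> verts G - {v}"
  unfolding nbrs_def using edge_verts(2,3)[of G v] by blast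

lemma finite_nbrs: "simple_graph G \<Longrightarrow> finite (nbrs G v)"
  using nbrs_subset[of G v] unfolding simple_graph_def by (meson finite_Diff finite_subset)

lemma degree_eq_card_nbrs:
  assumes "simple_graph G"
  shows "degree G v = card (nbrs G v)"
proof -
  have "{e \<in> edges G. v \<in> e} = (\<lambda>w. {v, w}) ` nbrs G v"
  proof (intro equalityI subsetI)
    fix e assume e: "e \<in> {e \<in> edges G. v \<in> e}"
    then have "card e = 2" using assms by (auto simp: simple_graph_def)
    then obtain a b where "e = {a, b}" by (auto simp: card_2_iff)
    then show "e \<in> (\<lambda>w. {v, w}) ` nbrs G v"
      using e by (auto simp: nbrs_def insert_commute)
  qed (auto simp: nbrs_def)
  moreover have "inj_on (\<lambda>w. {v, w}) (nbrs G v)"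
    by (auto simp: inj_on_def doubleton_eq_iff)
  ultimately show ?thesis by (simp add: degree_def card_image)
qed

lemma degree_less_card_verts:
  assumes "simple_graph G" "v \<in> verts G"
  shows "degree G v < card (verts G)"
proof -
  have fin: "finite (verts G)" using assms(1) by (simp add: simple_graph_def)
  have "card (nbrs G v) \<le> card (verts G - {v})"
    using nbrs_subset[OF assms(1)] fin by (intro card_mono) auto
  also have "\<dots> < card (verts G)"
    using assms(2) fin by (intro card_Diff1_less)
  finally show ?thesis using assms(1) by (simp add: degree_eq_card_nbrs)
qed

lemma sum_degree:
  assumes "simple_graph G"
  shows "(\<Sum>v\<in>verts G. degree G v) = 2 * card (edges G)"
proof -
  have fin: "finite (verts G)" using assms by (simp add: simple_graph_def)
  have "(\<Sum>v\<in>verts G. degree G v) = (\<Sum>e\<in>edges G. card {v \<in> verts G. v \<in> e})"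
    unfolding degree_def using fin finite_edges[OF assms]
    by (intro sum_multicount_gen) auto
  also have "\<dots> = (\<Sum>e\<in>edges G. 2)"
  proof (rule sum.cong[OF refl])
    fix e assume "e \<in> edges G"
    then have "{v \<in> verts G. v \<in> e} = e" "card e = 2"
      using assms by (auto simp: simple_graph_def)
    then show "card {v \<in> verts G. v \<in> e} = 2" by simp
  qed
  finally show ?thesis by simp
qed

text \<open>Adjacency is symmetric, so discounting \<open>v\<close> and \<open>x\<close> themselves
  costs both neighbourhoods the same and the strict comparison of degrees survives.\<close>

lemma private_neighbour:
  assumes G: "simple_graph G" and less: "degree G v < degree G x"
  obtains u where "{x, u} \<in> edges G" "{v, u} \<notin> edges G" "u \<noteq> v" "u \<noteq> x" "u \<in> verts G"
proof -
  have "\<not> nbrs G x - {v} \<subseteq> nbrs G v - {x}"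
  proof
    assume sub: "nbrs G x - {v} \<subseteq> nbrs G v - {x}"
    have split: "card (nbrs G y) = card (nbrs G y - {z}) + of_bool (z \<in> nbrs G y)" for y z
      using card_Suc_Diff1[OF finite_nbrs[OF G], of z y] by (cases "z \<in> nbrs G y") auto
    have "card (nbrs G x - {v}) \<le> card (nbrs G v - {x})"
      using finite_nbrs[OF G] by (intro card_mono[OF _ sub]) auto
    moreover have "v \<in> nbrs G x \<longleftrightarrow> x \<in> nbrs G v" by (simp add: nbrs_def insert_commute)
    ultimately have "card (nbrs G x) \<le> card (nbrs G v)"
      using split[of x v] split[of v x] by (simp only: add_le_mono1)
    then show False using less by (simp add: degree_eq_card_nbrs[OF G])
  qed
  then obtain u where u: "u \<in> nbrs G x" "u \<noteq> v" "u \<notin> nbrs G v - {x}" by blast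
  with nbrs_subset[OF G, of x] that show thesis by (auto simp: nbrs_def)
qed

section \<open>The Erdos-Gallai condition is sufficient\<close>

text \<open>The invariant of the construction of Tripathi, Venugopalan and West: the vertices
  below \<open>r\<close> have reached their degree, and the vertices above \<open>r\<close> are independent.\<close>

definition subrealization :: "nat \<Rightarrow> (nat \<Rightarrow> nat) \<Rightarrow> nat \<Rightarrow> nat graph \<Rightarrow> bool" where
  "subrealization n d r G \<longleftrightarrow> simple_graph G \<and> verts G = {..<n} \<and>
     (\<forall>i<n. degree G i \<le> d i) \<and> (\<forall>i<r. degree G i = d i) \<and>
     (\<forall>i j. {i, j} \<in> edges G \<longrightarrow> i \<le> r \<or> j \<le> r)"

text \<open>Each vertex of the clique sees its \<open>r\<close> other members. The remaining edges
  join the clique to the independent set above \<open>r\<close> and are counted from there. This is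
  the Erdos-Gallai bound with actual degrees in place of the minima.\<close>

lemma clique_degree_sum:
  assumes G: "simple_graph G" and V: "verts G = {..<n}"
    and clique: "\<And>i j. i < j \<Longrightarrow> j \<le> r \<Longrightarrow> {i, j} \<in> edges G"
    and indep: "\<And>i j. {i, j} \<in> edges G \<Longrightarrow> i \<le> r \<or> j \<le> r"
  shows "(\<Sum>i\<le>r. degree G i) = r * (r + 1) + (\<Sum>i\<in>{r<..<n}. degree G i)"
proof -
  have E: "{i, j} \<in> edges G \<longleftrightarrow> {j, i} \<in> edges G" for i j by (simp add: insert_commute)
  have "degree G i = r + card {w \<in> {r<..<n}. {i, w} \<in> edges G}" if "i \<le> r" for i
  proof -
    have "nbrs G i = ({..r} - {i}) \<union> {w \<in> {r<..<n}. {i, w} \<in> edges G}"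
    proof (intro equalityI subsetI)
      fix w assume w: "w \<in> nbrs G i"
      then have "w < n" "w \<noteq> i" using nbrs_subset[OF G, of i] V by auto
      with w show "w \<in> ({..r} - {i}) \<union> {w \<in> {r<..<n}. {i, w} \<in> edges G}"
        by (cases "w \<le> r") (auto simp: nbrs_def)
    next
      fix w assume w: "w \<in> ({..r} - {i}) \<union> {w \<in> {r<..<n}. {i, w} \<in> edges G}"
      show "w \<in> nbrs G i"
      proof (cases w i rule: linorder_cases)
        case less
        then show ?thesis using clique[of w i] that by (simp add: nbrs_def insert_commute)
      next
        case greater
        then show ?thesis using clique[of i w] w by (auto simp: nbrs_def)
      qed (use w that in auto)
    qed
    moreover have "({..r} - {i}) \<inter> {w \<in> {r<..<n}. {i, w} \<in> edges G} = {}" by auto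
    ultimately show ?thesis
      using that by (simp add: degree_eq_card_nbrs[OF G] card_Un_disjoint)
  qed
  then have "(\<Sum>i\<le>r. degree G i) = r * (r + 1) + (\<Sum>i\<le>r. card {w \<in> {r<..<n}. {i, w} \<in> edges G})"
    by (simp add: sum.distrib algebra_simps)
  also have "(\<Sum>i\<le>r. card {w \<in> {r<..<n}. {i, w} \<in> edges G}) =
      (\<Sum>w\<in>{r<..<n}. card {i \<in> {..r}. {i, w} \<in> edges G})"
    by (rule sum_multicount_gen) auto
  also have "\<dots> = (\<Sum>w\<in>{r<..<n}. degree G w)"
  proof (rule sum.cong[OF refl])
    fix w assume "w \<in> {r<..<n}"
    then have "{i \<in> {..r}. {i, w} \<in> edges G} = nbrs G w"
      using indep by (fastforce simp: nbrs_def E)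
    then show "card {i \<in> {..r}. {i, w} \<in> edges G} = degree G w"
      by (simp add: degree_eq_card_nbrs[OF G])
  qed
  finally show ?thesis .
qed

text \<open>If nothing improves \<open>r\<close>, exchanges show that \<open>{..r}\<close> is a
  clique (\<open>case1\<close>, \<open>case3\<close>) and that every unsaturated vertex above
  \<open>r\<close> is joined to all of it (\<open>case0\<close>, \<open>case2\<close>). Then the
  degrees of \<open>{..r}\<close> already sum to at least the Erdos-Gallai bound, which contradicts
  the deficit at \<open>r\<close>.\<close>

lemma subrealization_improve:
  assumes mono: "\<And>i j. i \<le> j \<Longrightarrow> j < n \<Longrightarrow> d j \<le> d i"
    and even: "even (\<Sum>i<n. d i)" and r: "r < n"
    and EG: "r < d r \<Longrightarrow>
      (\<Sum>i\<le>r. d i) \<le> r * (r + 1) + (\<Sum>i\<in>{r<..<n}. min (d i) (r + 1))"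
    and sub: "subrealization n d r G" and less: "degree G r < d r"
  shows "\<exists>G'. subrealization n d r G' \<and> degree G r < degree G' r"
proof (rule ccontr)
  assume no: "\<not> ?thesis"
  have maximal: False
    if "simple_graph G'" "verts G' = {..<n}" "\<And>i. i < n \<Longrightarrow> degree G' i \<le> d i"
      "\<And>i. i < r \<Longrightarrow> degree G' i = d i" "\<And>i j. {i, j} \<in> edges G' \<Longrightarrow> i \<le> r \<or> j \<le> r"
      "degree G r < degree G' r" for G'
    using no that unfolding subrealization_def by blast
  have G: "simple_graph G" and V: "verts G = {..<n}" and le: "\<And>i. i < n \<Longrightarrow> degree G i \<le> d i"
    and eq: "\<And>i. i < r \<Longrightarrow> degree G i = d i"
    and indep: "\<And>i j. {i, j} \<in> edges G \<Longrightarrow> i \<le> r \<or> j \<le> r"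
    using sub by (auto simp: subrealization_def)
  have E: "{i, j} \<in> edges G \<longleftrightarrow> {j, i} \<in> edges G" for i j by (simp add: insert_commute)
  \<comment> \<open>A saturated \<open>l < r\<close> has degree \<open>d l \<ge> d r\<close>, more
    than \<open>r\<close> has now; hence some \<open>u\<close> has an edge to \<open>l\<close> that
    can be swung to \<open>r\<close>.\<close>
  have priv: "\<exists>u<n. {u, l} \<in> edges G \<and> {u, r} \<notin> edges G \<and> u \<noteq> r \<and> u \<noteq> l" if "l < r" for l
  proof -
    have "degree G r < degree G l" using less eq[OF that] mono[of l r] that r by simp
    from private_neighbour[OF G this] show ?thesis using V E by (metis lessThan_iff)
  qed
  have case0: "{r, i} \<in> edges G" if i: "r < i" "i < n" "degree G i < d i" for i
  proof (rule ccontr)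
    assume non: "{r, i} \<notin> edges G"
    let ?G = "add_edge r i G"
    have "simple_graph ?G" using G V r i by (intro simple_graph_add_edge) auto
    moreover have deg: "degree ?G w = degree G w + (if w = r \<or> w = i then 1 else 0)" for w
      using degree_add_edge[OF G non, of w] i by (cases "w = r"; cases "w = i"; simp)
    moreover have "degree ?G w \<le> d w" if "w < n" for w
      using deg[of w] le[OF that] less i by (auto split: if_splits)
    moreover have "x \<le> r \<or> y \<le> r" if "{x, y} \<in> edges ?G" for x y
      using that indep by (auto simp: doubleton_eq_iff)
    ultimately show False
      using maximal[of ?G] V i eq by simp
  qed
  \<comment> \<open>Swing \<open>u i\<close> to \<open>u r\<close> and add \<open>i r\<close>:
    vertex \<open>i\<close> is repaid and \<open>r\<close> gains two. If only one unit is missing,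
    parity supplies an unsaturated \<open>j\<close> above \<open>r\<close>, and deleting
    \<open>r j\<close>, an edge by \<open>case0\<close>, takes the surplus away.\<close>
  have case1: "{i, r} \<in> edges G" if i: "i < r" for i
  proof (rule ccontr)
    assume non: "{i, r} \<notin> edges G"
    obtain u where u: "u < n" "{u, i} \<in> edges G" "{u, r} \<notin> edges G" "u \<noteq> r" "u \<noteq> i"
      using priv[OF i] by blast
    define G1 where "G1 = add_edge u r (del_edge u i G)"
    define G3 where "G3 = add_edge i r G1"
    have "r \<in> verts G" using r V by simp
    note shift = shift_edge[OF G u(2,3) this u(4), folded G1_def]
    have non1: "{i, r} \<notin> edges G1" using non u by (auto simp: G1_def doubleton_eq_iff)
    have s3: "simple_graph G3"
      unfolding G3_def using shift(1) i r V by (intro simple_graph_add_edge) (auto simp: G1_def)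
    have deg3: "degree G3 w = degree G w + (if w = r then 2 else 0)" for w
      using shift(2)[of w] degree_add_edge[OF shift(1) non1, of w, folded G3_def] i
      by (cases "w = r"; cases "w = i"; simp)
    have e3: "edges G3 = insert {i, r} (insert {u, r} (edges G - {{u, i}}))" "verts G3 = {..<n}"
      using V by (auto simp: G3_def G1_def)
    show False
    proof (cases "degree G r + 2 \<le> d r")
      case True
      have "degree G3 w \<le> d w" if "w < n" for w
        using deg3[of w] le[OF that] True by (auto split: if_splits)
      moreover have "x \<le> r \<or> y \<le> r" if "{x, y} \<in> edges G3" for x y
        using that indep by (auto simp: e3 doubleton_eq_iff)
      ultimately show ?thesis
        using maximal[of G3] s3 e3 eq deg3 by simp
    next
      case False
      then have dr: "d r = degree G r + 1" using less by simp
      \<comment> \<open>Otherwise \<open>r\<close> alone falls short, by one, and \<open>d\<close>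
        would sum to an odd number.\<close>
      have "\<exists>j>r. j < n \<and> degree G j < d j"
      proof (rule ccontr)
        assume none: "\<not> ?thesis"
        have "d j = degree G j + of_bool (j = r)" if "j < n" for j
        proof (cases j r rule: linorder_cases)
          case greater
          then have "\<not> degree G j < d j" using none that by blast
          then show ?thesis using le[OF that] greater by simp
        qed (use dr eq in auto)
        then have "(\<Sum>j<n. d j) = (\<Sum>j<n. degree G j + of_bool (j = r))"
          by (intro sum.cong) auto
        also have "\<dots> = 2 * card (edges G) + 1"
          using sum_degree[OF G] V r by (simp add: sum.distrib of_bool_def)
        finally show False using even by simp
      qed
      then obtain j where j: "r < j" "j < n" "degree G j < d j" by blast
      have rj: "{r, j} \<in> edges G" by (rule case0[OF j])
      then have "j \<noteq> u" using u(3) by (auto simp: insert_commute)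
      define G4 where "G4 = del_edge r j G3"
      have s4: "simple_graph G4" using s3 by (simp add: G4_def simple_graph_del_edge)
      have "{r, j} \<in> edges G3" using rj j i u by (auto simp: e3 doubleton_eq_iff)
      then have deg4: "degree G4 w + of_bool (w = j) = degree G w + of_bool (w = r)" for w
        using degree_del_edge[OF s3, of r j w, folded G4_def] deg3[of w] j
        by (cases "w = r"; cases "w = j"; simp)
      have "degree G4 w \<le> d w" if "w < n" for w
        using deg4[of w] le[OF that] dr by (auto simp: of_bool_def split: if_splits)
      moreover have "degree G4 w = d w" if "w < r" for w
        using deg4[of w] eq[OF that] that j by auto
      moreover have "x \<le> r \<or> y \<le> r" if "{x, y} \<in> edges G4" for x y
        using that indep by (auto simp: G4_def e3 doubleton_eq_iff)
      moreover have "degree G r < degree G4 r" using deg4[of r] j by auto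
      ultimately show ?thesis
        using maximal[of G4] s4 e3(2) by (simp add: G4_def)
    qed
  qed
  \<comment> \<open>Swing \<open>u l\<close> to \<open>u r\<close> and repay \<open>l\<close> with
    the edge \<open>i l\<close>; both \<open>r\<close> and \<open>i\<close> gain one.\<close>
  have case2: "{i, l} \<in> edges G" if i: "r < i" "i < n" "degree G i < d i" and l: "l < r" for i l
  proof (rule ccontr)
    assume non: "{i, l} \<notin> edges G"
    obtain u where u: "u < n" "{u, l} \<in> edges G" "{u, r} \<notin> edges G" "u \<noteq> r" "u \<noteq> l"
      using priv[OF l] by blast
    have "u \<noteq> i" using u non by auto
    define G1 where "G1 = add_edge u r (del_edge u l G)"
    define G3 where "G3 = add_edge i l G1"
    have "r \<in> verts G" using r V by simp
    note shift = shift_edge[OF G u(2,3) this u(4), folded G1_def]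
    have non1: "{i, l} \<notin> edges G1" using non i l \<open>u \<noteq> i\<close> by (auto simp: G1_def doubleton_eq_iff)
    have s3: "simple_graph G3"
      unfolding G3_def using shift(1) i l r V by (intro simple_graph_add_edge) (auto simp: G1_def)
    have deg3: "degree G3 w = degree G w + (if w = r \<or> w = i then 1 else 0)" for w
      using shift(2)[of w] degree_add_edge[OF shift(1) non1, of w, folded G3_def] i l
      by (cases "w = r"; cases "w = i"; cases "w = l"; simp)
    have "x \<le> r \<or> y \<le> r" if "{x, y} \<in> edges G3" for x y
      using that indep l by (auto simp: G3_def G1_def doubleton_eq_iff)
    moreover have "verts G3 = {..<n}" using V by (simp add: G3_def G1_def)
    moreover have "degree G3 w \<le> d w" if "w < n" for w
      using deg3[of w] le[OF that] less i by (auto split: if_splits)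
    ultimately show False
      using maximal[of G3] s3 deg3 eq i by simp
  qed
  \<comment> \<open>Swing \<open>u i\<close> to \<open>u r\<close>, delete \<open>w j\<close>, and
    repay both \<open>i\<close> and \<open>j\<close> with the edge \<open>i j\<close>. Only
    \<open>w\<close> loses a unit, which is harmless because \<open>case1\<close> puts it above
    \<open>r\<close>. The vertices \<open>u\<close> and \<open>w\<close> may coincide.\<close>
  have case3: "{i, j} \<in> edges G" if ij: "i < j" "j < r" for i j
  proof (rule ccontr)
    assume non: "{i, j} \<notin> edges G"
    have "i < r" using ij by simp
    obtain u where u: "u < n" "{u, i} \<in> edges G" "{u, r} \<notin> edges G" "u \<noteq> r" "u \<noteq> i"
      using priv[OF \<open>i < r\<close>] by blast
    obtain w where w: "w < n" "{w, j} \<in> edges G" "{w, r} \<notin> edges G" "w \<noteq> r" "w \<noteq> j"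
      using priv[OF \<open>j < r\<close>] by blast
    have "r < u" "r < w" using case1 u w by (meson linorder_neqE_nat)+
    define G1 where "G1 = add_edge u r (del_edge u i G)"
    define G2 where "G2 = del_edge w j G1"
    define G4 where "G4 = add_edge i j G2"
    have "r \<in> verts G" using r V by simp
    note shift = shift_edge[OF G u(2,3) this u(4), folded G1_def]
    have old1: "{w, j} \<in> edges G1"
      using w u ij \<open>r < u\<close> by (auto simp: G1_def doubleton_eq_iff)
    have s2: "simple_graph G2" using shift(1) by (simp add: G2_def simple_graph_del_edge)
    have non2: "{i, j} \<notin> edges G2"
      using non ij \<open>r < u\<close> by (auto simp: G1_def G2_def doubleton_eq_iff)
    have s4: "simple_graph G4"
      unfolding G4_def using s2 ij r V by (intro simple_graph_add_edge) (auto simp: G1_def G2_def)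
    have deg4: "degree G4 x + of_bool (x = w) = degree G x + of_bool (x = r)" for x
      using shift(2)[of x] degree_del_edge[OF shift(1) old1, of x, folded G2_def]
        degree_add_edge[OF s2 non2, of x, folded G4_def] ij \<open>r < w\<close>
      by (cases "x = r"; cases "x = i"; cases "x = j"; simp)
    have "degree G4 x \<le> d x" if "x < n" for x
      using deg4[of x] le[OF that] less by (auto simp: of_bool_def split: if_splits)
    moreover have "degree G4 x = d x" if "x < r" for x
      using deg4[of x] eq[OF that] that \<open>r < w\<close> by auto
    moreover have "x \<le> r \<or> y \<le> r" if "{x, y} \<in> edges G4" for x y
      using that indep ij by (auto simp: G4_def G2_def G1_def doubleton_eq_iff)
    moreover have "degree G r < degree G4 r" using deg4[of r] w by auto
    moreover have "verts G4 = {..<n}" using V by (simp add: G4_def G2_def G1_def)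
    ultimately show False
      using maximal[of G4] s4 by simp
  qed
  have "{..<r} \<subseteq> nbrs G r" using case1 by (auto simp: nbrs_def E)
  then have "r \<le> degree G r"
    using card_mono[OF finite_nbrs[OF G], of "{..<r}" r] by (simp add: degree_eq_card_nbrs[OF G])
  then have "(\<Sum>i\<le>r. d i) \<le> r * (r + 1) + (\<Sum>i\<in>{r<..<n}. min (d i) (r + 1))"
    using less by (intro EG) simp
  also have "(\<Sum>i\<in>{r<..<n}. min (d i) (r + 1)) \<le> (\<Sum>i\<in>{r<..<n}. degree G i)"
  proof (rule sum_mono)
    fix i assume i: "i \<in> {r<..<n}"
    show "min (d i) (r + 1) \<le> degree G i"
    proof (cases "degree G i < d i")
      case True
      then have "{..r} \<subseteq> nbrs G i"
        using i case0[of i] case2[of i] by (auto simp: nbrs_def E le_less)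
      then show ?thesis
        using card_mono[OF finite_nbrs[OF G], of "{..r}" i] by (simp add: degree_eq_card_nbrs[OF G])
    qed simp
  qed
  also have "r * (r + 1) + (\<Sum>i\<in>{r<..<n}. degree G i) = (\<Sum>i\<le>r. degree G i)"
    using clique_degree_sum[OF G V] case1 case3 indep by (simp add: le_less) metis
  also have "\<dots> < (\<Sum>i\<le>r. d i)"
    using le r less by (intro sum_strict_mono_ex1) auto
  finally show False by simp
qed

text \<open>Vertices are saturated in order; at each stage a subrealization with the greatest degree
  at \<open>r\<close> is chosen. The inequality is demanded only for \<open>r < d r\<close>, since a
  stuck stage contains the clique \<open>{..r}\<close> and so has
  \<open>r \<le> degree G r < d r\<close>.\<close>

theorem Erdos_Gallai_sufficient:
  assumes mono: "\<And>i j. i \<le> j \<Longrightarrow> j < n \<Longrightarrow> d j \<le> d i"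
    and even: "even (\<Sum>i<n. d i)"
    and EG: "\<And>r. r < n \<Longrightarrow> r < d r \<Longrightarrow>
      (\<Sum>i\<le>r. d i) \<le> r * (r + 1) + (\<Sum>i\<in>{r<..<n}. min (d i) (r + 1))"
  obtains G :: "nat graph"
  where "simple_graph G" "verts G = {..<n}" "\<And>i. i < n \<Longrightarrow> degree G i = d i"
proof -
  have "\<exists>G. subrealization n d r G \<and> (\<forall>i j. {i, j} \<in> edges G \<longrightarrow> i < r \<or> j < r)" if "r \<le> n" for r
    using that
  proof (induction r)
    case 0
    have "subrealization n d 0 \<lparr>verts = {..<n}, edges = {}\<rparr>"
      by (simp add: subrealization_def simple_graph_def degree_def)
    then show ?case by fastforce
  next
    case (Suc r)
    then have r: "r < n" by simp
    obtain G0 where "subrealization n d r G0" using Suc by auto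
    moreover have bound: "degree G r \<le> d r" if "subrealization n d r G" for G
      using that r by (simp add: subrealization_def)
    ultimately obtain G where G: "subrealization n d r G"
      and max: "\<And>G'. subrealization n d r G' \<Longrightarrow> degree G' r \<le> degree G r"
      using ex_has_greatest_nat[of "subrealization n d r" G0 "\<lambda>G. degree G r" "Suc (d r)"]
      by (auto simp: less_Suc_eq_le)
    have "\<not> degree G r < d r"
      using subrealization_improve[OF mono even r EG[OF r] G] max by (metis not_le)
    then have "degree G r = d r" using bound[OF G] by simp
    then have "subrealization n d (Suc r) G"
      using G by (fastforce simp: subrealization_def less_Suc_eq)
    moreover have "i < Suc r \<or> j < Suc r" if "{i, j} \<in> edges G" for i j
      using G that unfolding subrealization_def less_Suc_eq_le by blast
    ultimately show ?case by blast
  qed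
  from this[of n] show thesis using that by (auto simp: subrealization_def)
qed

section \<open>Two degree conditions\<close>

text \<open>The criterion wants decreasing sequences, while \<open>P_seq\<close> is listed in
  increasing order.\<close>

lemma graphic_rev_map:
  assumes "\<And>i j. i \<le> j \<Longrightarrow> j < n \<Longrightarrow> d j \<le> d i" "even (\<Sum>i<n. d i)"
    and "\<And>r. r < n \<Longrightarrow> r < d r \<Longrightarrow>
      (\<Sum>i\<le>r. d i) \<le> r * (r + 1) + (\<Sum>i\<in>{r<..<n}. min (d i) (r + 1))"
  shows "graphic (rev (map d [0..<n]))"
proof -
  obtain G :: "nat graph"
    where "simple_graph G" "verts G = {..<n}" "\<And>i. i < n \<Longrightarrow> degree G i = d i"
    using Erdos_Gallai_sufficient[of n d] assms by blast
  then show ?thesis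
    unfolding graphic_def
    by (intro exI[of _ G] exI[of _ "rev [0..<n]"]) (auto simp: rev_map)
qed

text \<open>The theorem of Zverovich and Zverovich. For \<open>r \<ge> b\<close> the slack in the Erdos-Gallai
  inequality is at least \<open>(r + 1)\<^sup>2 - (a + b + 1) (r + 1) + n b\<close>, whose discriminant is not positive.\<close>

lemma EG_condition_Zverovich:
  fixes d :: "nat \<Rightarrow> nat" and a b n r :: nat
  assumes ub: "\<And>i. i < n \<Longrightarrow> d i \<le> a" and lb: "\<And>i. i < n \<Longrightarrow> b \<le> d i" and "b \<ge> 1"
    and n: "(a + b + 1)\<^sup>2 \<le> 4 * b * n" and r: "r < n"
  shows "(\<Sum>i\<le>r. d i) \<le> r * (r + 1) + (\<Sum>i\<in>{r<..<n}. min (d i) (r + 1))"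
proof -
  have "(\<Sum>i\<le>r. d i) \<le> (\<Sum>i\<le>r. a)" using ub r by (intro sum_mono) auto
  also have "\<dots> = (r + 1) * a" by simp
  also have "\<dots> \<le> r * (r + 1) + (n - (r + 1)) * min b (r + 1)"
  proof (cases "r + 1 \<le> b")
    case True
    \<comment> \<open>The square gives \<open>4 * b * (a + 1) \<le> (a + b + 1)\<^sup>2\<close>, so
      the hypothesis on \<open>n\<close> yields \<open>a < n\<close>, which is all that is needed
      while \<open>r + 1 \<le> b\<close>.\<close>
    have "0 \<le> (int a + 1 - int b)\<^sup>2" by simp
    then have "int (4 * b * (a + 1)) \<le> int ((a + b + 1)\<^sup>2)"
      by (simp add: power2_eq_square algebra_simps)
    then have "4 * b * (a + 1) \<le> 4 * b * n" using n by linarith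
    from mult_left_le_imp_le[OF this] have "a + 1 \<le> n" using \<open>b \<ge> 1\<close> by simp
    then have "a \<le> r + (n - (r + 1))" by simp
    then have "(r + 1) * a \<le> (r + 1) * (r + (n - (r + 1)))" by (rule mult_le_mono2)
    then show ?thesis using True by (simp add: min_def algebra_simps)
  next
    case False
    define x where "x = int r + 1"
    have diff: "int (n - (r + 1)) = int n - x" using r by (simp add: x_def)
    have "0 \<le> (2 * x - (int a + int b + 1))\<^sup>2" by simp
    moreover have "int ((a + b + 1)\<^sup>2) \<le> int (4 * b * n)"
      using n by (simp only: of_nat_le_iff)
    ultimately have "x * int a \<le> (x - 1) * x + (int n - x) * int b"
      by (simp add: power2_eq_square algebra_simps)
    then have "int ((r + 1) * a) \<le> int (r * (r + 1) + (n - (r + 1)) * b)"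
      unfolding of_nat_mult of_nat_add diff by (simp add: x_def algebra_simps)
    moreover have "min b (r + 1) = b" using False by simp
    ultimately show ?thesis by (simp only: of_nat_le_iff)
  qed
  also have "(n - (r + 1)) * min b (r + 1) = (\<Sum>i\<in>{r<..<n}. min b (r + 1))" by simp
  also have "\<dots> \<le> (\<Sum>i\<in>{r<..<n}. min (d i) (r + 1))"
    using lb by (intro sum_mono) (auto simp: min_le_iff_disj)
  finally show ?thesis by simp
qed

text \<open>Count the pairs with \<open>j \<le> r\<close> and \<open>j < d i\<close> in both ways.
  Since \<open>r < d r\<close>, the indices up to \<open>r\<close> account for
  \<open>(r + 1) * (r + 1)\<close> of them and the others for the sum of minima. The
  \<open>+ 1\<close> in \<open>le\<close> makes up for the difference to
  \<open>r * (r + 1)\<close>.\<close>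

lemma EG_condition_conjugate:
  fixes d :: "nat \<Rightarrow> nat"
  assumes mono: "\<And>i j. i \<le> j \<Longrightarrow> j < n \<Longrightarrow> d j \<le> d i" and r: "r < n" "r < d r"
    and le: "(\<Sum>j\<le>r. d j + 1) \<le> (\<Sum>j\<le>r. card {i. i < n \<and> j < d i})"
  shows "(\<Sum>i\<le>r. d i) \<le> r * (r + 1) + (\<Sum>i\<in>{r<..<n}. min (d i) (r + 1))"
proof -
  have conj: "card {i. i < n \<and> j < d i} = (r + 1) + card {i \<in> {r<..<n}. j < d i}" if "j \<le> r" for j
  proof -
    have "j < d i" if "i \<le> r" for i
      using mono[OF that r(1)] r(2) \<open>j \<le> r\<close> by simp
    then have "{i. i < n \<and> j < d i} = {..r} \<union> {i \<in> {r<..<n}. j < d i}"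
      using r(1) by auto
    moreover have "{..r} \<inter> {i \<in> {r<..<n}. j < d i} = {}" by auto
    moreover have "finite {i \<in> {r<..<n}. j < d i}" by (rule finite_subset[of _ "{..<n}"]) auto
    ultimately show ?thesis by (simp add: card_Un_disjoint)
  qed
  have "(\<Sum>i\<in>{r<..<n}. min (d i) (r + 1)) = (\<Sum>i\<in>{r<..<n}. card {j \<in> {..r}. j < d i})"
  proof (rule sum.cong[OF refl])
    fix i
    have "{j \<in> {..r}. j < d i} = {..<min (d i) (r + 1)}" by auto
    then show "min (d i) (r + 1) = card {j \<in> {..r}. j < d i}" by simp
  qed
  also have "\<dots> = (\<Sum>j\<le>r. card {i \<in> {r<..<n}. j < d i})"
    by (rule sum_multicount_gen) auto
  finally have "(\<Sum>j\<le>r. card {i. i < n \<and> j < d i}) =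
      (r + 1) * (r + 1) + (\<Sum>i\<in>{r<..<n}. min (d i) (r + 1))"
    using conj by (simp add: sum.distrib sum_Suc)
  moreover have "(\<Sum>j\<le>r. d j + 1) = (\<Sum>j\<le>r. d j) + (r + 1)" by (simp add: sum_Suc)
  ultimately show ?thesis using le by simp
qed

text \<open>The differences \<open>g j\<close> between the conjugate sequence and the sequence are nonnegative
  for \<open>j < \<delta>\<close> and strictly decreasing from \<open>\<delta> - 1\<close> on. Since consecutive terms differ by at most
  one, \<open>g\<close> is at least \<open>-1\<close> at the end of the Durfee square, and this loss is
  compensated by \<open>g (\<delta> - 1) \<ge> 1\<close>.\<close>

lemma conjugate_staircase:
  fixes \<delta> s n r :: nat
  defines "d \<equiv> \<lambda>i. \<delta> + (n - 1 - i) div s"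
  assumes \<delta>: "\<delta> \<ge> 1" and s: "s \<ge> 2" and max: "\<delta> + (n - 1) div s < n"
    and r: "r < n" "r < d r"
  shows "(\<Sum>j\<le>r. d j + 1) \<le> (\<Sum>j\<le>r. card {i. i < n \<and> j < d i})"
proof -
  \<comment> \<open>The conjugate is \<open>n - s * (j + 1 - \<delta>)\<close> with truncation at 0;
    dropping the outer truncation only lowers the difference and makes it linear in \<open>j\<close>
    from \<open>\<delta> - 1\<close> on. The inner truncation is kept: it gives the value
    \<open>n\<close> for \<open>j < \<delta>\<close>.\<close>
  define g where "g j = int n - int s * int (j + 1 - \<delta>) - 1 - int (d j)" for j
  have conj: "card {i. i < n \<and> j < d i} = n - s * (j + 1 - \<delta>)" for j
  proof -
    have "j < d i \<longleftrightarrow> s * (j + 1 - \<delta>) \<le> n - 1 - i" for i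
      using less_eq_div_iff_mult_less_eq[of s "j + 1 - \<delta>" "n - 1 - i"] s
      by (auto simp: d_def mult.commute[of s])
    moreover have "0 < s * (j + 1 - \<delta>)" if "\<not> j < d i" for i
      using that s by (simp add: d_def)
    ultimately have "{i. i < n \<and> j < d i} = {..<n - s * (j + 1 - \<delta>)}" by fastforce
    then show ?thesis by simp
  qed
  have g_le: "g j \<le> int (card {i. i < n \<and> j < d i}) - int (d j + 1)" for j
  proof -
    have "int n - int (s * (j + 1 - \<delta>)) \<le> int (n - s * (j + 1 - \<delta>))" by linarith
    then show ?thesis by (simp add: conj g_def)
  qed
  have small: "g j \<ge> 0" if "j < \<delta>" for j
  proof -
    have "(n - 1 - j) div s \<le> (n - 1) div s" by (intro div_le_mono) simp
    then show ?thesis using that max by (simp add: g_def d_def)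
  qed
  have dstep: "d j \<le> d (j + 1) + 1" if "j + 1 < n" for j
  proof -
    have "(n - 1 - j) div s \<le> (n - 1 - (j + 1) + s) div s"
      using that s by (intro div_le_mono) simp
    also have "\<dots> = (n - 1 - (j + 1)) div s + 1" using s by simp
    finally show ?thesis by (simp add: d_def)
  qed
  have drop: "g (j + 1) + 1 \<le> g j" if "\<delta> \<le> j + 1" "j + 1 < n" for j
  proof -
    have "int (j + 1 + 1 - \<delta>) = int (j + 1 - \<delta>) + 1" using that by simp
    then have "g j - g (j + 1) = int s - int (d j) + int (d (j + 1))"
      by (simp add: g_def algebra_simps)
    then show ?thesis using dstep[OF that(2)] s by linarith
  qed
  have decr: "g i + int (i - j) \<le> g j" if "\<delta> \<le> j + 1" "j \<le> i" "i < n" for i j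
    using that(2,3)
  proof (induction i rule: dec_induct)
    case (step i)
    then show ?case using drop[of i] that(1) by (simp add: Suc_diff_le)
  qed simp
  \<comment> \<open>The last index inside the Durfee square.\<close>
  define K where "K = Max {j. j < n \<and> j < d j}"
  have "K \<in> {j. j < n \<and> j < d j}" unfolding K_def using r by (intro Max_in) auto
  then have K: "K < n" "K < d K" by auto
  have "r \<le> K" unfolding K_def using r by (intro Max_ge) auto
  have "K + 1 < n"
  proof (rule ccontr)
    assume "\<not> K + 1 < n"
    then have "d K = \<delta>" "K = n - 1" using K(1) by (auto simp: d_def)
    then show False using K(2) max by linarith
  qed
  have "\<not> K + 1 < d (K + 1)"
  proof
    assume "K + 1 < d (K + 1)"
    then have "K + 1 \<le> K"
      using \<open>K + 1 < n\<close> unfolding K_def[symmetric] by (subst (2) K_def) (intro Max_ge, auto)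
    then show False by simp
  qed
  then have dK: "d K \<le> K + 2" "d K = K + 2 \<Longrightarrow> K < d (K + 1)"
    using dstep[OF \<open>K + 1 < n\<close>] by linarith+
  \<comment> \<open>All of the first \<open>d K\<close> terms exceed \<open>K\<close>, so the
    conjugate at \<open>K\<close> is at least \<open>d K\<close>; the \<open>-1\<close> is the
    diagonal unit subtracted in \<open>g\<close>.\<close>
  have gK: "g K \<ge> -1"
  proof -
    have "K < d i" if "i < d K" for i
    proof (cases "i \<le> K")
      case True
      then have "d K \<le> d i" unfolding d_def by (intro add_left_mono div_le_mono) simp
      then show ?thesis using K(2) by simp
    next
      case False
      then have "i = K + 1" "d K = K + 2" using that dK(1) by linarith+
      then show ?thesis using dK(2) by simp
    qed
    then have "{..<d K} \<subseteq> {i. i < n \<and> K < d i}" using dK(1) \<open>K + 1 < n\<close> by auto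
    then have "card {..<d K} \<le> card {i. i < n \<and> K < d i}" by (intro card_mono) auto
    then have "d K + s * (K + 1 - \<delta>) \<le> n" using K(2) unfolding conj by simp
    then have "int (d K + s * (K + 1 - \<delta>)) \<le> int n" by (simp only: of_nat_le_iff)
    then show ?thesis by (simp add: g_def)
  qed
  have "0 \<le> (\<Sum>j\<le>r. g j)"
  proof (cases "r < \<delta>")
    case True
    then show ?thesis using small by (intro sum_nonneg) auto
  next
    case False
    \<comment> \<open>As \<open>r \<ge> \<delta>\<close> lies in the Durfee square, its quotient is
      nonzero, so \<open>n - \<delta> \<ge> s + 1 \<ge> 3\<close>; dividing by
      \<open>s \<ge> 2\<close> then loses enough.\<close>
    have one: "g (\<delta> - 1) \<ge> 1"
    proof -
      have "(n - 1 - r) div s \<noteq> 0" using False r(2) by (auto simp: d_def)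
      then have "s \<le> n - 1 - r" using s by (auto simp: div_eq_0_iff)
      then have "3 \<le> n - \<delta>" using False s by linarith
      moreover have "(n - \<delta>) div s \<le> (n - \<delta>) div 2" using s by (intro div_le_mono2) auto
      ultimately have "(n - \<delta>) div s + 2 \<le> n - \<delta>" by linarith
      moreover have "n - 1 - (\<delta> - 1) = n - \<delta>" using \<delta> by simp
      ultimately show ?thesis using \<delta> by (simp add: g_def d_def)
    qed
    \<comment> \<open>For \<open>\<delta> \<le> j < r \<le> K\<close> the strict decrease lifts the
      value \<open>-1\<close> at \<open>K\<close> to at least 0, so only the last summand can be
      negative.\<close>
    have "0 \<le> (\<Sum>j\<in>{..<r}-{\<delta>-1}. g j)"
    proof (intro sum_nonneg)
      fix j assume "j \<in> {..<r} - {\<delta> - 1}"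
      then show "0 \<le> g j"
        using small[of j] decr[of j K] K \<open>r \<le> K\<close> gK by (cases "j < \<delta>") auto
    qed
    moreover have "g r \<ge> -1" using decr[of r K] False K \<open>r \<le> K\<close> gK by auto
    moreover have "(\<Sum>j\<le>r. g j) = g r + (g (\<delta> - 1) + (\<Sum>j\<in>{..<r}-{\<delta>-1}. g j))"
      using False \<delta> by (subst sum.remove[symmetric]) (auto simp: lessThan_Suc_atMost[symmetric])
    ultimately show ?thesis using one by linarith
  qed
  also have "\<dots> \<le> (\<Sum>j\<le>r. int (card {i. i < n \<and> j < d i}) - int (d j + 1))"
    by (rule sum_mono) (rule g_le)
  also have "\<dots> = int (\<Sum>j\<le>r. card {i. i < n \<and> j < d i}) - int (\<Sum>j\<le>r. d j + 1)"
    by (simp add: sum_subtractf)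
  finally show ?thesis by linarith
qed

section \<open>The sequence P\<close>

lemma s_condition_iff:
  assumes "t \<ge> 1"
  shows "s_condition t n m \<delta> h s \<longleftrightarrow>
    n \<le> (t + 1) * s \<and> t * s \<le> n \<and> 4 * m + s * h * t * (t + 1) = 2 * n * (\<delta> + t * h)"
proof -
  have "real n / (real t + 1) \<le> real s \<longleftrightarrow> real n \<le> real ((t + 1) * s)"
    by (simp add: divide_le_eq algebra_simps)
  moreover have "real s \<le> real n / real t \<longleftrightarrow> real (t * s) \<le> real n"
    using assms by (simp add: le_divide_eq algebra_simps)
  moreover have "2 * real m = real n * (real \<delta> + real t * real h)
       - real s * real h * real t * (real t + 1) / 2 \<longleftrightarrow>
     real (4 * m + s * h * t * (t + 1)) = real (2 * n * (\<delta> + t * h))"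
    by (simp add: algebra_simps) argo
  ultimately show ?thesis unfolding s_condition_def of_nat_le_iff of_nat_eq_iff by blast
qed

text \<open>With \<open>h = k + 1\<close> this is the equation in \<open>s_condition_iff\<close>;
  only the range of \<open>s\<close> distinguishes the two conditions.\<close>

lemma eq_f_bound_iff:
  assumes "t \<ge> 1"
  shows "real s = f_bound t n m \<delta> k \<longleftrightarrow>
    4 * m + s * (k + 1) * t * (t + 1) = 2 * n * (\<delta> + t * (k + 1))"
proof -
  have "(real k + 1) * real t * (real t + 1) \<noteq> 0" using assms by simp
  then have "real s = f_bound t n m \<delta> k \<longleftrightarrow>
      real s * ((real k + 1) * real t * (real t + 1))
        = 2 * (real n * (real \<delta> + real t * (real k + 1)) - 2 * real m)"
    unfolding f_bound_def by (rule nonzero_eq_divide_eq)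
  also have "\<dots> \<longleftrightarrow> real (4 * m + s * (k + 1) * t * (t + 1)) = real (2 * n * (\<delta> + t * (k + 1)))"
    by (simp add: algebra_simps)
  finally show ?thesis unfolding of_nat_eq_iff .
qed

lemma concat_replicate_eq_map_div:
  assumes "0 < s"
  shows "concat (map (\<lambda>i. replicate s (f i)) [0..<t]) = map (\<lambda>i. f (i div s)) [0..<t * s]"
proof (induction t)
  case (Suc t)
  have "[0..<Suc t * s] = [0..<t * s] @ [t * s..<t * s + s]"
    using upt_add_eq_append[of 0 "t * s" s] by (simp add: add.commute[of s])
  moreover have "map (\<lambda>i. f (i div s)) [t * s..<t * s + s] = replicate s (f t)"
  proof (rule replicate_eqI)
    fix y assume "y \<in> set (map (\<lambda>i. f (i div s)) [t * s..<t * s + s])"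
    then obtain i where "y = f (i div s)" "t * s \<le> i" "i < t * s + s" by auto
    moreover from this have "i div s = t" by (intro div_nat_eqI) (auto simp: algebra_simps)
    ultimately show "y = f t" by simp
  qed simp
  ultimately show ?case using Suc by simp
qed simp

lemma P_seq_eq_map:
  assumes "0 < s" "t * s \<le> n" "n \<le> (t + 1) * s"
  shows "P_seq t n \<delta> h s = map (\<lambda>i. \<delta> + i div s * h) [0..<n]"
proof -
  have "[0..<n] = [0..<t * s] @ [t * s..<n]"
    using assms(2) upt_add_eq_append[of 0 "t * s" "n - t * s"] by simp
  moreover have "map (\<lambda>i. \<delta> + i div s * h) [t * s..<n] = replicate (n - t * s) (\<delta> + t * h)"
  proof (rule replicate_eqI)
    fix y assume "y \<in> set (map (\<lambda>i. \<delta> + i div s * h) [t * s..<n])"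
    then obtain i where "y = \<delta> + i div s * h" "t * s \<le> i" "i < n"
      unfolding set_map set_upt by fastforce
    moreover from this have "i div s = t"
      using assms(3) by (intro div_nat_eqI) (auto simp: algebra_simps)
    ultimately show "y = \<delta> + t * h" by simp
  qed simp
  ultimately show ?thesis
    using concat_replicate_eq_map_div[OF assms(1), of "\<lambda>i. \<delta> + i * h" t]
    unfolding P_seq_def by simp
qed

lemma card_div_fiber:
  fixes s t n :: nat
  assumes "0 < s" "t * s \<le> n" "n \<le> (t + 1) * s"
  shows "card {i. i < n \<and> i div s = c} = (if c < t then s else if c = t then n - t * s else 0)"
proof -
  have iff: "i div s = c \<longleftrightarrow> c * s \<le> i \<and> i < (c + 1) * s" for i
    using div_less_iff_less_mult[OF assms(1), of i "c + 1"]
      less_eq_div_iff_mult_less_eq[OF assms(1), of c i] by linarith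
  have "{i. i < n \<and> i div s = c} = {c * s..<min n ((c + 1) * s)}"
    unfolding iff by auto
  then have card: "card {i. i < n \<and> i div s = c} = min n ((c + 1) * s) - c * s" by simp
  show ?thesis
  proof (cases c t rule: linorder_cases)
    case less
    then have "(c + 1) * s \<le> t * s" by (intro mult_le_mono1) simp
    then have "min n ((c + 1) * s) = (c + 1) * s" using assms(2) by (intro min_absorb2) linarith
    then show ?thesis unfolding card using less by simp
  next
    case equal
    then have "min n ((c + 1) * s) = n" using assms(3) by (intro min_absorb1) simp
    then show ?thesis unfolding card using equal by simp
  next
    case greater
    then have "(t + 1) * s \<le> c * s" by (intro mult_le_mono1) simp
    then have "min n ((c + 1) * s) \<le> c * s" using assms(3) by (intro min.coboundedI1) linarith
    then show ?thesis unfolding card using greater by simp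
  qed
qed

text \<open>Expresses the shortfall below class \<open>t\<close> through class sizes, the quantities
  that \<open>sp\<close> bounds. It is applied both to \<open>P\<close> and to an arbitrary
  graph.\<close>

lemma sum_deficit:
  fixes q :: "'a \<Rightarrow> nat"
  assumes "finite V"
  shows "(\<Sum>v\<in>V. t - q v) = (\<Sum>c<t. (t - c) * card {v \<in> V. q v = c})"
proof -
  have "(\<Sum>v\<in>V. t - q v) = (\<Sum>v\<in>V. \<Sum>c<t. if q v = c then t - c else 0)"
    by (intro sum.cong) auto
  also have "\<dots> = (\<Sum>c<t. \<Sum>v\<in>V. if q v = c then t - c else 0)" by (rule sum.swap)
  also have "\<dots> = (\<Sum>c<t. (t - c) * card {v \<in> V. q v = c})"
    using assms by (intro sum.cong) (auto simp flip: sum.inter_filter)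
  finally show ?thesis .
qed

lemma double_sum_diff: "2 * (\<Sum>c<t. (t - c) * s) = s * t * (t + 1)" for s t :: nat
  by (induction t) (simp_all add: sum.lessThan_Suc_shift algebra_simps del: sum.lessThan_Suc diff_mult_distrib)

text \<open>Complement each quotient to \<open>t\<close>: the complements sum to
  \<open>s * t * (t + 1) / 2\<close>, the term in the edge-count condition.\<close>

lemma sum_P:
  fixes s t n m h \<delta> :: nat
  assumes "0 < s" "t * s \<le> n" "n \<le> (t + 1) * s"
    and eq: "4 * m + s * h * t * (t + 1) = 2 * n * (\<delta> + t * h)"
  shows "(\<Sum>i<n. \<delta> + i div s * h) = 2 * m"
proof -
  have "i div s \<le> t" if "i < n" for i
    using less_mult_imp_div_less[of i "t + 1" s] that assms(3) by simp
  then have "(\<Sum>i<n. i div s) + (\<Sum>i<n. t - i div s) = (\<Sum>i<n. t)"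
    by (subst sum.distrib[symmetric]) (intro sum.cong, auto)
  moreover have "(\<Sum>i<n. t - i div s) = (\<Sum>c<t. (t - c) * s)"
    unfolding sum_deficit[OF finite_lessThan]
    using card_div_fiber[OF assms(1-3)] by (intro sum.cong) auto
  ultimately have "2 * (\<Sum>i<n. i div s) + s * t * (t + 1) = 2 * (n * t)"
    using double_sum_diff[of t s] by simp
  then have "(2 * (\<Sum>i<n. i div s) + s * t * (t + 1)) * h = 2 * (n * t) * h" by simp
  moreover have "(\<Sum>i<n. \<delta> + i div s * h) = n * \<delta> + (\<Sum>i<n. i div s) * h"
    by (simp add: sum.distrib sum_distrib_right)
  ultimately show ?thesis using eq by (simp add: algebra_simps)
qed

lemma graphic_P:
  fixes t n \<delta> h s m :: nat
  defines "d \<equiv> \<lambda>i. \<delta> + (n - 1 - i) div s * h"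
  assumes P: "0 < s" "t * s \<le> n" "n \<le> (t + 1) * s"
    and eq: "4 * m + s * h * t * (t + 1) = 2 * n * (\<delta> + t * h)"
    and EG: "\<And>r. r < n \<Longrightarrow> r < d r \<Longrightarrow>
      (\<Sum>i\<le>r. d i) \<le> r * (r + 1) + (\<Sum>i\<in>{r<..<n}. min (d i) (r + 1))"
  shows "graphic (P_seq t n \<delta> h s)"
proof -
  have "d j \<le> d i" if "i \<le> j" for i j
    unfolding d_def using that by (intro add_left_mono mult_right_mono div_le_mono) auto
  moreover have "(\<Sum>i<n. d i) = 2 * m"
    using sum.nat_diff_reindex[of "\<lambda>i. \<delta> + i div s * h" n] sum_P[OF P eq] by (simp add: d_def)
  ultimately have "graphic (rev (map d [0..<n]))" using EG by (intro graphic_rev_map) auto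
  moreover have "rev (map d [0..<n]) = P_seq t n \<delta> h s"
    unfolding P_seq_eq_map[OF P] by (rule nth_equalityI) (auto simp: rev_nth d_def)
  ultimately show ?thesis by simp
qed

text \<open>The terms lie between \<open>b = \<delta>\<close> and
  \<open>a = \<delta> + t * h\<close>, so \<open>a + b + 1\<close> is the base of the
  square.\<close>

lemma graphic_P_Zverovich:
  assumes P: "0 < s" "t * s \<le> n" "n \<le> (t + 1) * s"
    and eq: "4 * m + s * h * t * (t + 1) = 2 * n * (\<delta> + t * h)" and \<delta>: "\<delta> \<ge> 1"
    and n: "(2 * \<delta> + t * h + 1)\<^sup>2 \<le> 4 * \<delta> * n"
  shows "graphic (P_seq t n \<delta> h s)"
proof (rule graphic_P[OF P eq])
  fix r assume r: "r < n"
  have "(n - 1 - i) div s < t + 1" if "i < n" for i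
    using that P by (intro less_mult_imp_div_less) simp
  then have "\<delta> + (n - 1 - i) div s * h \<le> \<delta> + t * h" if "i < n" for i
    using that by (intro add_left_mono mult_right_mono) (auto simp: less_Suc_eq_le)
  moreover have "\<delta> + t * h + \<delta> + 1 = 2 * \<delta> + t * h + 1" by simp
  then have "(\<delta> + t * h + \<delta> + 1)\<^sup>2 \<le> 4 * \<delta> * n" using n by (simp only:)
  ultimately show "(\<Sum>i\<le>r. \<delta> + (n - 1 - i) div s * h)
      \<le> r * (r + 1) + (\<Sum>i\<in>{r<..<n}. min (\<delta> + (n - 1 - i) div s * h) (r + 1))"
    using r \<delta> by (intro EG_condition_Zverovich[where b = \<delta>]) auto
qed

lemma graphic_P_staircase:
  assumes P: "0 < s" "t * s \<le> n" "n \<le> (t + 1) * s"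
    and eq: "4 * m + s * 1 * t * (t + 1) = 2 * n * (\<delta> + t * 1)" and \<delta>: "\<delta> \<ge> 1"
    and max: "\<delta> + (n - 1) div s < n"
  shows "graphic (P_seq t n \<delta> 1 s)"
proof (rule graphic_P[OF P eq])
  fix r assume r: "r < n" "r < \<delta> + (n - 1 - r) div s * 1"
  \<comment> \<open>For \<open>s = 1\<close> the largest term would be
    \<open>\<delta> + n - 1 \<ge> n\<close>.\<close>
  have "s \<noteq> 1" using max \<delta> by auto
  then have s: "s \<ge> 2" using P(1) by simp
  have "(\<Sum>i\<le>r. \<delta> + (n - 1 - i) div s)
      \<le> r * (r + 1) + (\<Sum>i\<in>{r<..<n}. min (\<delta> + (n - 1 - i) div s) (r + 1))"
  proof (rule EG_condition_conjugate)
    show "(\<Sum>j\<le>r. \<delta> + (n - 1 - j) div s + 1)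
        \<le> (\<Sum>j\<le>r. card {i. i < n \<and> j < \<delta> + (n - 1 - i) div s})"
      using conjugate_staircase[OF \<delta> s max] r by simp
  qed (use r in \<open>auto intro!: div_le_mono\<close>)
  then show "(\<Sum>i\<le>r. \<delta> + (n - 1 - i) div s * 1)
      \<le> r * (r + 1) + (\<Sum>i\<in>{r<..<n}. min (\<delta> + (n - 1 - i) div s * 1) (r + 1))"
    by simp
qed

section \<open>Graphs attaining the bound\<close>

lemma card_le_sp:
  assumes G: "simple_graph G" and B: "B \<subseteq> verts G"
    and near: "\<And>u v. u \<in> B \<Longrightarrow> v \<in> B \<Longrightarrow> degree G u \<le> degree G v + k"
  shows "card B \<le> sp G k"
proof (cases "B = {}")
  case False
  have fin: "finite (verts G)" using G by (simp add: simple_graph_def)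
  then have "finite (degree G ` B)" using B by (auto dest: finite_subset)
  then have "Max (degree G ` B) \<in> degree G ` B" "Min (degree G ` B) \<in> degree G ` B"
    using False by (intro Max_in Min_in; simp)+
  then obtain u v where "u \<in> B" "v \<in> B" "Max (degree G ` B) = degree G u" "Min (degree G ` B) = degree G v"
    by auto
  then have "spread G B \<le> int k" using near[of u v] by (simp add: spread_def)
  then show ?thesis
    unfolding sp_def using fin B False by (intro Max_ge) auto
qed simp

lemma sp_le:
  assumes G: "simple_graph G" and "verts G \<noteq> {}"
    and le: "\<And>B. B \<subseteq> verts G \<Longrightarrow> B \<noteq> {} \<Longrightarrow>
      (\<And>u v. u \<in> B \<Longrightarrow> v \<in> B \<Longrightarrow> degree G u \<le> degree G v + k) \<Longrightarrow> card B \<le> s"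
  shows "sp G k \<le> s"
proof -
  have fin: "finite (verts G)" using G by (simp add: simple_graph_def)
  obtain v where "v \<in> verts G" using assms(2) by blast
  \<comment> \<open>Singletons have spread 0, so the \<open>Max\<close> in \<open>sp\<close> is over
    a nonempty set.\<close>
  then have "{v} \<in> {B. B \<subseteq> verts G \<and> B \<noteq> {} \<and> spread G B \<le> int k}" by (simp add: spread_def)
  moreover have "card B \<le> s" if B: "B \<subseteq> verts G" "B \<noteq> {}" "spread G B \<le> int k" for B
  proof (rule le[OF B(1,2)])
    fix u v assume "u \<in> B" "v \<in> B"
    moreover have "finite (degree G ` B)" using B(1) fin by (auto dest: finite_subset)
    ultimately have "degree G u \<le> Max (degree G ` B)" "Min (degree G ` B) \<le> degree G v" by auto
    then show "degree G u \<le> degree G v + k" using B(3) by (simp add: spread_def)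
  qed
  ultimately show ?thesis
    unfolding sp_def using fin by (subst Max_le_iff) auto
qed

text \<open>All degrees are congruent modulo \<open>k + 1\<close>, so a set of spread at most
  \<open>k\<close> has a single degree. No degree occurs more than \<open>s\<close> times, and
  \<open>\<delta>\<close> occurs exactly \<open>s\<close> times because
  \<open>t \<ge> 1\<close>.\<close>

lemma attains_if_graphic:
  assumes P: "0 < s" "t * s \<le> n" "n \<le> (t + 1) * s"
    and eq: "4 * m + s * (k + 1) * t * (t + 1) = 2 * n * (\<delta> + t * (k + 1))"
    and t: "t \<ge> 1" and "graphic (P_seq t n \<delta> (k + 1) s)"
  obtains G :: "nat graph" where "simple_graph G" "card (verts G) = n" "card (edges G) = m"
    "min_degree G = \<delta>" "sp G k = s"
proof -
  have n: "0 < n"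
    using P(1,2) t by (metis gr0I le_zero_eq mult_is_0 not_one_le_zero)
  obtain G :: "nat graph" and vs where G: "simple_graph G" and vs: "distinct vs" "set vs = verts G"
    and map: "map (degree G) vs = map (\<lambda>i. \<delta> + i div s * (k + 1)) [0..<n]"
    using assms(6) unfolding graphic_def P_seq_eq_map[OF P] by blast
  have len: "length vs = n" using arg_cong[OF map, of length] by simp
  then have card: "card (verts G) = n" using vs by (metis distinct_card)
  have deg: "degree G (vs ! i) = \<delta> + i div s * (k + 1)" if "i < n" for i
    using that arg_cong[OF map, of "\<lambda>xs. xs ! i"] len by simp
  have bij: "bij_betw ((!) vs) {..<n} (verts G)"
    using bij_betw_nth[OF vs(1) _ vs(2)[symmetric]] len by simp
  have "2 * card (edges G) = (\<Sum>i<n. degree G (vs ! i))"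
    using sum_degree[OF G] sum.reindex_bij_betw[OF bij, of "degree G"] by simp
  also have "\<dots> = (\<Sum>i<n. \<delta> + i div s * (k + 1))" using deg by (intro sum.cong) auto
  also have "\<dots> = 2 * m" by (rule sum_P[OF P eq])
  finally have "card (edges G) = m" by simp
  have verts: "\<exists>i<n. v = vs ! i" if "v \<in> verts G" for v
    using that bij by (auto simp: bij_betw_def)
  have "min_degree G = \<delta>"
    unfolding min_degree_def
  proof (rule Min_eqI)
    show "finite (degree G ` verts G)" using vs(2) by (metis List.finite_set finite_imageI)
    have "vs ! 0 \<in> verts G" using bij_betw_apply[OF bij, of 0] n by simp
    then show "\<delta> \<in> degree G ` verts G" using deg[OF n] by (intro image_eqI) auto
    show "\<delta> \<le> y" if "y \<in> degree G ` verts G" for y using that verts deg by fastforce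
  qed
  have class_card: "card {v \<in> verts G. degree G v = \<delta> + c * (k + 1)} = card {i. i < n \<and> i div s = c}" for c
  proof -
    have "degree G (vs ! i) = \<delta> + c * (k + 1) \<longleftrightarrow> i div s = c" if "i < n" for i
      unfolding deg[OF that] add_left_cancel mult_cancel2 by simp
    then have "{i \<in> {..<n}. degree G (vs ! i) = \<delta> + c * (k + 1)} = {i. i < n \<and> i div s = c}"
      by (intro Collect_cong) auto
    moreover have "verts G = (!) vs ` {..<n}" using bij by (simp add: bij_betw_def)
    ultimately have "{v \<in> verts G. degree G v = \<delta> + c * (k + 1)} = (!) vs ` {i. i < n \<and> i div s = c}"
      by (simp only: Compr_image_eq)
    moreover have "inj_on ((!) vs) {i. i < n \<and> i div s = c}"
      using bij by (auto simp: bij_betw_def intro: inj_on_subset)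
    ultimately show ?thesis by (simp add: card_image)
  qed
  have "sp G k = s"
  proof (rule antisym)
    show "sp G k \<le> s"
    proof (rule sp_le[OF G])
      show "verts G \<noteq> {}" using card n by auto
      fix B assume B: "B \<subseteq> verts G" "B \<noteq> {}"
        and near: "\<And>u v. u \<in> B \<Longrightarrow> v \<in> B \<Longrightarrow> degree G u \<le> degree G v + k"
      have form: "\<exists>c. degree G v = \<delta> + c * (k + 1)" if "v \<in> B" for v
        using that B(1) verts deg by blast
      obtain b c where b: "b \<in> B" "degree G b = \<delta> + c * (k + 1)" using B(2) form by blast
      have "degree G v = \<delta> + c * (k + 1)" if v: "v \<in> B" for v
      proof -
        obtain c' where c': "degree G v = \<delta> + c' * (k + 1)" using form[OF v] by blast
        have "x \<le> y" if "x * (k + 1) \<le> y * (k + 1) + k" for x y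
        proof (rule ccontr)
          assume "\<not> x \<le> y"
          then have "(y + 1) * (k + 1) \<le> x * (k + 1)" by (intro mult_le_mono1) simp
          then show False using that by simp
        qed
        from this[of c c'] this[of c' c] have "c' = c" using near[OF b(1) v] near[OF v b(1)] b(2) c' by simp
        then show ?thesis using c' by simp
      qed
      then have "card B \<le> card {v \<in> verts G. degree G v = \<delta> + c * (k + 1)}"
        using B(1) G by (intro card_mono) (auto simp: simple_graph_def)
      also have "\<dots> \<le> s"
        unfolding class_card card_div_fiber[OF P] using P(3) by auto
      finally show "card B \<le> s" .
    qed
    have "s = card {v \<in> verts G. degree G v = \<delta> + 0 * (k + 1)}"
      unfolding class_card card_div_fiber[OF P] using t by simp
    also have "\<dots> \<le> sp G k" by (rule card_le_sp[OF G]) auto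
    finally show "s \<le> sp G k" .
  qed
  then show thesis using that G card \<open>card (edges G) = m\<close> \<open>min_degree G = \<delta>\<close> by blast
qed

text \<open>The losses are \<open>O'\<close> (excess above class \<open>t\<close>), \<open>R\<close>
  (remainders) and \<open>X\<close> (weighted vacancies in the classes below \<open>t\<close>). Once
  they vanish, the class sizes determine every degree.\<close>

lemma graphic_if_attains:
  fixes G :: "nat graph"
  assumes G: "simple_graph G" and card: "card (verts G) = n" and "card (edges G) = m"
    and min: "min_degree G = \<delta>" and n: "n > 0"
    and eq: "4 * m + sp G k * (k + 1) * t * (t + 1) = 2 * n * (\<delta> + t * (k + 1))"
  shows "0 < sp G k" "t * sp G k \<le> n" "n \<le> (t + 1) * sp G k"
    "graphic (P_seq t n \<delta> (k + 1) (sp G k))"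
proof -
  define V h s where "V = verts G" and "h = k + 1" and "s = sp G k"
  define q where "q v = (degree G v - \<delta>) div h" for v
  define \<rho> where "\<rho> v = (degree G v - \<delta>) mod h" for v
  define c where "c i = card {v \<in> V. q v = i}" for i
  have fin: "finite V" using G by (simp add: V_def simple_graph_def)
  have h: "h > 0" by (simp add: h_def)
  have "\<delta> \<le> degree G v" if "v \<in> V" for v
    using that fin min by (auto simp: min_degree_def V_def)
  then have deg: "degree G v = \<delta> + (h * q v + \<rho> v)" if "v \<in> V" for v
    using that by (simp add: q_def \<rho>_def)
  have c_le: "c i \<le> s" for i
    unfolding c_def s_def
  proof (rule card_le_sp[OF G])
    fix u v assume u: "u \<in> {v \<in> V. q v = i}" and v: "v \<in> {v \<in> V. q v = i}"
    have "\<rho> u \<le> k" using mod_less_divisor[OF h, of "degree G u - \<delta>"] by (simp add: \<rho>_def h_def)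
    then show "degree G u \<le> degree G v + k" using deg[of u] deg[of v] u v by auto
  qed (auto simp: V_def)
  define A R D O' X where "A = (\<Sum>v\<in>V. q v)" and "R = (\<Sum>v\<in>V. \<rho> v)" and "D = (\<Sum>v\<in>V. t - q v)"
    and "O' = (\<Sum>v\<in>V. q v - t)" and "X = (\<Sum>i<t. (t - i) * (s - c i))"
  have "2 * m = (\<Sum>v\<in>V. \<delta> + (h * q v + \<rho> v))"
    using sum_degree[OF G] \<open>card (edges G) = m\<close> deg by (simp add: V_def)
  then have sum: "2 * m = n * \<delta> + h * A + R"
    using card by (simp add: sum.distrib sum_distrib_left A_def R_def V_def)
  have "A + D = (\<Sum>v\<in>V. t + (q v - t))"
    unfolding A_def D_def sum.distrib[symmetric] by (intro sum.cong) auto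
  then have AD: "A + D = n * t + O'" using card by (simp add: sum.distrib O'_def V_def)
  have "D + X = (\<Sum>i<t. (t - i) * s)"
    unfolding D_def X_def sum_deficit[OF fin] sum.distrib[symmetric]
  proof (rule sum.cong[OF refl])
    fix i
    show "(t - i) * card {v \<in> V. q v = i} + (t - i) * (s - c i) = (t - i) * s"
      using c_le[of i] by (simp add: c_def distrib_left[symmetric])
  qed
  then have DX: "2 * (D + X) = s * t * (t + 1)"
    using double_sum_diff[of t s] by simp
  have "2 * (n * \<delta> + h * A + R) + s * h * t * (t + 1) = 2 * n * (\<delta> + t * h)"
    using eq sum by (simp add: s_def h_def)
  moreover have "s * h * t * (t + 1) = h * (2 * (D + X))" unfolding DX by (simp add: algebra_simps)
  moreover have "h * (A + D) = h * (n * t + O')" by (simp add: AD)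
  \<comment> \<open>Eliminating \<open>A\<close> and \<open>D\<close> leaves only nonnegative
    terms.\<close>
  ultimately have "h * O' + R + h * X = 0" by (simp only: algebra_simps)
  then have zero: "O' = 0" "R = 0" "X = 0" using h by auto
  have q_le: "q v \<le> t" if "v \<in> V" for v using zero(1) that fin by (simp add: O'_def)
  have deg': "degree G v = \<delta> + q v * h" if "v \<in> V" for v
    using zero(2) that fin deg[OF that] by (simp add: R_def)
  have c_eq: "c i = s" if "i < t" for i
    using zero(3) that c_le[of i] by (auto simp: X_def intro: antisym)
  have "n = (\<Sum>i\<le>t. c i)"
    unfolding c_def card_eq_sum card[symmetric] V_def[symmetric]
    using q_le fin by (intro sum.group[symmetric]) auto
  also have "\<dots> = t * s + c t" using c_eq by (simp add: lessThan_Suc_atMost[symmetric])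
  finally have nt: "n = t * s + c t" .
  show P: "0 < sp G k" "t * sp G k \<le> n" "n \<le> (t + 1) * sp G k"
    using nt c_le[of t] n unfolding s_def[symmetric] by (auto intro: gr0I)
  note P' = P[folded s_def]
  have "image_mset q (mset_set V) = image_mset (\<lambda>i. i div s) (mset_set {..<n})"
  proof (rule multiset_eqI)
    fix i
    have "c i = card {j. j < n \<and> j div s = i}"
    proof (cases "i \<le> t")
      case True
      have "n - t * s = c t" using nt by simp
      then show ?thesis unfolding card_div_fiber[OF P'] using True c_eq by auto
    next
      case False
      then have empty: "{v \<in> V. q v = i} = {}" using q_le by fastforce
      show ?thesis using False unfolding card_div_fiber[OF P'] c_def empty by simp
    qed
    then show "count (image_mset q (mset_set V)) i = count (image_mset (\<lambda>i. i div s) (mset_set {..<n})) i"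
      using fin by (simp add: count_image_mset_eq_card_vimage c_def)
  qed
  then have "image_mset (\<lambda>x. \<delta> + x * h) (image_mset q (mset_set V)) =
      image_mset (\<lambda>x. \<delta> + x * h) (image_mset (\<lambda>i. i div s) (mset_set {..<n}))" by simp
  moreover have "image_mset (\<lambda>x. \<delta> + x * h) (image_mset q (mset_set V)) = image_mset (degree G) (mset_set V)"
    using deg' fin by (auto simp: multiset.map_comp intro!: image_mset_cong)
  ultimately have mset: "image_mset (degree G) (mset_set V) = mset (P_seq t n \<delta> h s)"
    unfolding P_seq_eq_map[OF P'] by (simp add: multiset.map_comp comp_def atLeast0LessThan)
  \<comment> \<open>\<open>graphic\<close> accepts any enumeration of the vertices, so sorting by
    degree upgrades the equality of multisets to one of lists.\<close>
  define vs where "vs = sort_key (degree G) (sorted_list_of_set V)"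
  have "sorted (P_seq t n \<delta> h s)"
    unfolding P_seq_eq_map[OF P'] by (auto simp: sorted_iff_nth_mono intro!: div_le_mono)
  moreover have "mset (map (degree G) vs) = mset (P_seq t n \<delta> h s)"
    using mset fin mset_set_set[of "sorted_list_of_set V"] by (simp add: vs_def)
  ultimately have "map (degree G) vs = P_seq t n \<delta> h s"
    using properties_for_sort[of "P_seq t n \<delta> h s" "map (degree G) vs"]
      properties_for_sort[of "map (degree G) vs" "map (degree G) vs"] by (simp add: vs_def)
  then show "graphic (P_seq t n \<delta> (k + 1) (sp G k))"
    unfolding graphic_def s_def h_def using G fin by (intro exI[of _ G] exI[of _ vs]) (simp add: vs_def V_def)
qed

theorem theorem10:
  fixes \<delta> k h t n m :: nat
  assumes "\<delta> \<ge> 1" and "h = k + 1" and "t \<ge> 1" and "n \<ge> 2" and "2 * m \<ge> n * \<delta>"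
  shows "((\<exists>G :: nat graph. simple_graph G \<and> card (verts G) = n \<and> card (edges G) = m \<and>
              min_degree G = \<delta> \<and> real (sp G k) = f_bound t n m \<delta> k)
            \<longleftrightarrow> (\<exists>s. s_condition t n m \<delta> h s \<and> graphic (P_seq t n \<delta> h s))) \<and>
         (\<forall>s. s_condition t n m \<delta> h s \<longrightarrow>
            (real n \<ge> (2 * real \<delta> + real t * real h + 1)\<^sup>2 / (4 * real \<delta>) \<longrightarrow>
               graphic (P_seq t n \<delta> h s)) \<and>
            (k = 0 \<longrightarrow> (graphic (P_seq t n \<delta> h s) \<longleftrightarrow> n > Max (set (P_seq t n \<delta> h s)))))"
proof -
  have cond: "0 < s \<and> t * s \<le> n \<and> n \<le> (t + 1) * s
      \<and> 4 * m + s * h * t * (t + 1) = 2 * n * (\<delta> + t * h)" if "s_condition t n m \<delta> h s" for s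
    using that \<open>n \<ge> 2\<close> unfolding s_condition_iff[OF \<open>t \<ge> 1\<close>] by (auto intro: gr0I)
  have "\<exists>s. s_condition t n m \<delta> h s \<and> graphic (P_seq t n \<delta> h s)"
    if G: "simple_graph G" "card (verts G) = n" "card (edges G) = m" "min_degree G = \<delta>"
      and sp: "real (sp G k) = f_bound t n m \<delta> k" for G :: "nat graph"
  proof -
    have n: "n > 0" using \<open>n \<ge> 2\<close> by simp
    note eq = sp[unfolded eq_f_bound_iff[OF \<open>t \<ge> 1\<close>]]
    show ?thesis
      using graphic_if_attains[OF G n eq] eq unfolding s_condition_iff[OF \<open>t \<ge> 1\<close>] \<open>h = k + 1\<close> by blast
  qed
  moreover have "\<exists>G :: nat graph. simple_graph G \<and> card (verts G) = n \<and> card (edges G) = m \<and>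
      min_degree G = \<delta> \<and> real (sp G k) = f_bound t n m \<delta> k"
    if s: "s_condition t n m \<delta> h s" and graphic: "graphic (P_seq t n \<delta> h s)" for s
  proof -
    from cond[OF s] have P: "0 < s" "t * s \<le> n" "n \<le> (t + 1) * s"
      and eq: "4 * m + s * (k + 1) * t * (t + 1) = 2 * n * (\<delta> + t * (k + 1))"
      using \<open>h = k + 1\<close> by auto
    from attains_if_graphic[OF P eq \<open>t \<ge> 1\<close> graphic[unfolded \<open>h = k + 1\<close>]]
    obtain G :: "nat graph" where "simple_graph G" "card (verts G) = n" "card (edges G) = m"
      "min_degree G = \<delta>" "sp G k = s" .
    then show ?thesis using eq eq_f_bound_iff[OF \<open>t \<ge> 1\<close>] by blast
  qed
  moreover have "graphic (P_seq t n \<delta> h s)"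
    if s: "s_condition t n m \<delta> h s"
      and n: "real n \<ge> (2 * real \<delta> + real t * real h + 1)\<^sup>2 / (4 * real \<delta>)" for s
  proof -
    have "real ((2 * \<delta> + t * h + 1)\<^sup>2) \<le> real (4 * \<delta> * n)"
      using n \<open>\<delta> \<ge> 1\<close> by (simp add: divide_le_eq algebra_simps)
    then have "(2 * \<delta> + t * h + 1)\<^sup>2 \<le> 4 * \<delta> * n" by (simp only: of_nat_le_iff)
    with cond[OF s] \<open>\<delta> \<ge> 1\<close> show ?thesis by (blast intro: graphic_P_Zverovich)
  qed
  moreover have "graphic (P_seq t n \<delta> h s) \<longleftrightarrow> n > Max (set (P_seq t n \<delta> h s))"
    if s: "s_condition t n m \<delta> h s" and "k = 0" for s
  proof -
    from cond[OF s] have P: "0 < s" "t * s \<le> n" "n \<le> (t + 1) * s"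
      and eq: "4 * m + s * 1 * t * (t + 1) = 2 * n * (\<delta> + t * 1)"
      using \<open>h = k + 1\<close> \<open>k = 0\<close> by auto
    have h: "h = 1" using \<open>h = k + 1\<close> \<open>k = 0\<close> by simp
    note P_map = P_seq_eq_map[OF P, of \<delta> 1, simplified]
    have Max_less: "Max (set (P_seq t n \<delta> 1 s)) < n \<longleftrightarrow> (\<forall>x\<in>set (P_seq t n \<delta> 1 s). x < n)"
      using \<open>n \<ge> 2\<close> by (subst Max_less_iff) (auto simp: P_map)
    show ?thesis
      unfolding h
    proof
      assume "graphic (P_seq t n \<delta> 1 s)"
      then obtain G :: "nat graph" and vs where G: "simple_graph G" "distinct vs" "set vs = verts G"
        and map: "map (degree G) vs = P_seq t n \<delta> 1 s"
        unfolding graphic_def by blast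
      have "length vs = n" using arg_cong[OF map, of length] by (simp add: P_map)
      then have "card (verts G) = n" using G by (metis distinct_card)
      then have "\<forall>x\<in>set (map (degree G) vs). x < n"
        using degree_less_card_verts[OF G(1)] G(3) by simp
      then show "Max (set (P_seq t n \<delta> 1 s)) < n" unfolding Max_less map .
    next
      assume "Max (set (P_seq t n \<delta> 1 s)) < n"
      moreover have "\<delta> + (n - 1) div s \<in> set (P_seq t n \<delta> 1 s)"
        using \<open>n \<ge> 2\<close> by (auto simp: P_map)
      ultimately have "\<delta> + (n - 1) div s < n" using Max_less by blast
      then show "graphic (P_seq t n \<delta> 1 s)" by (rule graphic_P_staircase[OF P eq \<open>\<delta> \<ge> 1\<close>])
    qed
  qed
  ultimately show ?thesis by blast
qed

end
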